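(* Let $\mathbb F_q$ be a finite field with $q$ elements, let $n\ge 2$, let $a_1,\dots,a_n,b\in\mathbb F_q^*$, and let $m_1,\dots,m_n,k,k_1,\dots,k_n$ be positive integers. Put $M=\operatorname{lcm}[m_1,\dots,m_n]$ and $d_j=\gcd(m_j,q-1)$ for $j=1,\dots,n$. Assume that $$\gcd\Bigl(\sum_{j=1}^n \frac{k_jM}{m_j}-kM,\;q-1\Bigr)=1.$$ Then $$N\bigl[(a_1x_1^{m_1}+\dots+a_nx_n^{m_n})^k=bx_1^{k_1}\cdots x_n^{k_n}\bigr]=(q-1)^{n-1}+N\bigl[a_1x_1^{d_1}+\dots+a_nx_n^{d_n}=0\bigr]-\frac{q}{q-1}\,N^*\bigl[a_1x_1^{d_1}+\dots+a_nx_n^{d_n}=0\bigr].$$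
   Context: For polynomials $f_1,f_2$ over $\mathbb F_q$, $N[f_1(x_1,\dots,x_n)=f_2(x_1,\dots,x_n)]$ denotes the number of solutions $(x_1,\dots,x_n)\in\mathbb F_q^n$ of the equation, and $N^*[\cdot]$ denotes the number of such solutions with $x_1\cdots x_n\ne 0$. $\mathbb F_q^*=\mathbb F_q\setminus\{0\}$. *)

theory Defs
  imports Complex_Main "HOL-Library.FuncSet" "HOL-Library.Cardinality"
begin

text \<open>Points of F_q^n are represented as functions x :: nat => 'a on the
index set {1..n} (extensional outside, via PiE).\<close>

definition Npts :: "nat \<Rightarrow> ((nat \<Rightarrow> 'a::finite) \<Rightarrow> bool) \<Rightarrow> nat" where
  "Npts n P = card {x \<in> PiE {1..n} (\<lambda>_. (UNIV :: 'a set)). P x}"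

definition Nstar :: "nat \<Rightarrow> ((nat \<Rightarrow> 'a::{finite,zero}) \<Rightarrow> bool) \<Rightarrow> nat" where
  "Nstar n P = card {x \<in> PiE {1..n} (\<lambda>_. (UNIV :: 'a set)). (\<forall>j\<in>{1..n}. x j \<noteq> 0) \<and> P x}"

end

theory Submission
  imports Defs "HOL-Computational_Algebra.Primes"
begin

text \<open>
  If some coordinate of a solution vanishes, then both sides of the equation vanish, so such solutions
  are the zeros of \<open>\<Sum> a\<^sub>j x\<^sub>j^m\<^sub>j\<close> with a vanishing coordinate. On the torus
  the group \<open>F\<^sub>q\<^sup>*\<close> acts by \<open>x\<^sub>j \<mapsto> x\<^sub>j y^(M/m\<^sub>j)\<close>. This multiplies the quotient
  of the two sides of the equation by a power of \<open>y\<close> whose exponent is prime to \<open>q - 1\<close>, so that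
  every orbit on which \<open>\<Sum> a\<^sub>j x\<^sub>j^m\<^sub>j\<close> does not vanish is free and contains exactly one solution.
  Finally, \<open>m\<^sub>j\<close> may be replaced by \<open>d\<^sub>j\<close> because \<open>m\<^sub>j \<equiv> d\<^sub>j e\<close> modulo \<open>q - 1\<close> for some \<open>e\<close>
  prime to \<open>q - 1\<close>, and \<open>x \<mapsto> x^e\<close> permutes the field.
\<close>

section \<open>Power maps on a finite field\<close>

lemma finite_field_power_card_minus_1:
  fixes x :: "'a::{field,finite}"
  assumes "x \<noteq> 0"
  shows "x ^ (CARD('a) - 1) = 1"
proof -
  let ?U = "- {0::'a}"
  \<comment> \<open>Multiplication by \<open>x\<close> only permutes the nonzero elements, yet
    contributes one factor \<open>x\<close> per element to their nonzero product.\<close>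
  have bij: "bij_betw ((*) x) ?U ?U"
    by (rule bij_betw_byWitness[where f' = "\<lambda>y. y / x"]) (use assms in auto)
  have "(\<Prod>y\<in>?U. y) = (\<Prod>y\<in>?U. x * y)"
    by (rule prod.reindex_bij_betw[OF bij, symmetric])
  also have "\<dots> = x ^ card ?U * (\<Prod>y\<in>?U. y)"
    by (simp add: prod.distrib)
  finally have "x ^ card ?U = 1"
    by simp
  then show ?thesis
    by (simp add: Compl_eq_Diff_UNIV)
qed

text \<open>A Bezout relation \<open>u * E + v * (q - 1) = 1\<close> makes \<open>y powi u\<close>
  undo \<open>y powi E\<close>. The exponent is an integer because the difference of exponents it
  will be applied to may be negative.\<close>

lemma finite_field_powi_bij_betw:
  assumes "coprime E (int (CARD('a::{field,finite}) - 1))"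
  shows "bij_betw (\<lambda>y::'a. y powi E) (- {0}) (- {0})"
proof -
  obtain u v where uv: "u * E + v * int (CARD('a) - 1) = 1"
    using bezout_int[of E "int (CARD('a) - 1)"] assms by auto
  have "(y powi E) powi u = y" if "y \<noteq> 0" for y :: 'a
  proof -
    have "y = y powi (u * E + v * int (CARD('a) - 1))"
      by (simp only: uv power_int_1_right)
    also have "\<dots> = (y powi E) powi u * (y powi int (CARD('a) - 1)) powi v"
      using that by (simp add: power_int_add power_int_mult[symmetric] mult.commute)
    also have "y powi int (CARD('a) - 1) = 1"
      using finite_field_power_card_minus_1[OF that] by (simp only: power_int_of_nat)
    finally show ?thesis
      by simp
  qed
  then have "inj_on (\<lambda>y::'a. y powi E) (- {0})"
    by (intro inj_on_inverseI[where g = "\<lambda>y. y powi u"]) auto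
  moreover have "(\<lambda>y::'a. y powi E) ` (- {0}) \<subseteq> - {0}"
    by auto
  ultimately show ?thesis
    by (simp add: bij_betw_def endo_inj_surj)
qed

lemma finite_field_power_bij:
  assumes "e > 0" "coprime e (CARD('a::{field,finite}) - 1)"
  shows "bij (\<lambda>x::'a. x ^ e)"
proof -
  have "bij_betw (\<lambda>x::'a. x powi int e) (- {0}) (- {0})"
    by (rule finite_field_powi_bij_betw) (use assms(2) in \<open>simp only: coprime_int_iff\<close>)
  then have "bij_betw (\<lambda>x::'a. x ^ e) (- {0}) (- {0})"
    by simp
  moreover have "bij_betw (\<lambda>x::'a. x ^ e) {0} {0}"
    using assms(1) by (simp add: bij_betw_def)
  ultimately have "bij_betw (\<lambda>x::'a. x ^ e) (- {0} \<union> {0}) (- {0} \<union> {0})"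
    by (rule bij_betw_combine) auto
  then show ?thesis
    by (simp add: Un_commute)
qed

text \<open>Take \<open>t\<close> to be the product of the primes that divide \<open>N\<close> but
  not \<open>r\<close>. A prime divisor of \<open>N\<close> then divides exactly one of
  \<open>r\<close> and \<open>t * s\<close>: if it divides \<open>r\<close>, it divides neither
  \<open>s\<close> nor \<open>t\<close>; otherwise it divides \<open>t\<close>. Hence it never
  divides the sum.\<close>

lemma coprime_lift:
  fixes r s N :: nat
  assumes "coprime r s" "N > 0"
  shows "\<exists>t>0. coprime (r + t * s) N"
proof -
  define A where "A = {p. prime p \<and> p dvd N \<and> \<not> p dvd r}"
  have fin: "finite A"
    by (rule finite_subset[of _ "{..N}"]) (use assms(2) in \<open>auto simp: A_def dest: dvd_imp_le\<close>)
  define t where "t = \<Prod>A"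
  have "t > 0"
    unfolding t_def by (rule prod_pos) (auto simp: A_def prime_gt_0_nat)
  moreover have "coprime (r + t * s) N"
  proof (rule ccontr)
    assume "\<not> coprime (r + t * s) N"
    then have "gcd (r + t * s) N \<noteq> 1"
      by (simp add: coprime_iff_gcd_eq_1)
    then obtain p where "prime p" "p dvd gcd (r + t * s) N"
      using prime_factor_nat by blast
    then have p: "prime p" "p dvd r + t * s" "p dvd N"
      by auto
    show False
    proof (cases "p dvd r")
      case True
      with p have "p dvd t * s"
        by (simp add: dvd_add_right_iff)
      moreover have "\<not> p dvd s"
        using True assms(1) p(1) by (metis coprime_common_divisor not_prime_unit)
      ultimately have "p dvd t"
        using p(1) by (simp add: prime_dvd_mult_iff)
      then obtain q where "q \<in> A" "p dvd q"
        using prime_dvd_prod_iff[OF fin p(1), of "\<lambda>x. x"] by (auto simp: t_def)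
      then have "p = q"
        using p(1) by (auto simp: A_def primes_dvd_imp_eq)
      with \<open>q \<in> A\<close> True show False
        by (simp add: A_def)
    next
      case False
      with p have "p \<in> A"
        by (simp add: A_def)
      then have "p dvd t"
        unfolding t_def using fin by (rule dvd_prodI[rotated])
      with p(2) False show False
        by (simp add: dvd_add_left_iff)
    qed
  qed
  ultimately show ?thesis
    by blast
qed

text \<open>With \<open>m = d * r\<close> and \<open>q - 1 = d * s\<close>, replacing
  \<open>r\<close> by \<open>r + t * s\<close> changes the total exponent by a multiple of
  \<open>q - 1\<close>, which nonzero elements do not notice. Since \<open>r\<close> and
  \<open>s\<close> are coprime, some such \<open>t\<close> makes the new exponent prime to
  \<open>q - 1\<close>.\<close>

lemma finite_field_power_gcd:
  assumes "m > 0"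
  shows "\<exists>e>0. coprime e (CARD('a) - 1) \<and>
           (\<forall>x::'a::{field,finite}. (x ^ e) ^ gcd m (CARD('a) - 1) = x ^ m)"
proof -
  let ?N = "CARD('a) - 1" and ?d = "gcd m (CARD('a) - 1)"
  have N: "?N > 0"
    using card_mono[of "UNIV :: 'a set" "{0,1}"] by simp
  define r s where "r = m div ?d" and "s = ?N div ?d"
  have d: "?d > 0" and rs: "m = ?d * r" "?N = ?d * s"
    using assms by (simp_all add: r_def s_def)
  have "coprime r s"
    unfolding r_def s_def using assms by (intro div_gcd_coprime) simp
  then obtain t where t: "t > 0" "coprime (r + t * s) ?N"
    using coprime_lift[OF _ N] by blast
  have "(x ^ (r + t * s)) ^ ?d = x ^ m" for x :: 'a
  proof (cases "x = 0")
    case True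
    have "r > 0"
      using rs(1) assms by (metis mult_0_right neq0_conv)
    then have "r + t * s > 0"
      by simp
    with True assms d show ?thesis
      by (simp only: zero_power)
  next
    case False
    have "(x ^ (r + t * s)) ^ ?d = x ^ (?d * r + ?d * s * t)"
      by (simp only: power_mult[symmetric]) (simp only: algebra_simps)
    also have "\<dots> = x ^ m * (x ^ ?N) ^ t"
      by (simp only: rs[symmetric] power_add power_mult)
    finally show ?thesis
      by (simp only: finite_field_power_card_minus_1[OF False] power_one mult_1_right)
  qed
  moreover have "r + t * s > 0"
    using rs(1) assms by (metis add_gr_0 mult_0_right neq0_conv)
  ultimately show ?thesis
    using t by blast
qed

section \<open>Point counts under coordinatewise substitutions\<close>

lemma card_PiE_reindex_coordinates:
  fixes f :: "'i \<Rightarrow> 'a \<Rightarrow> 'a"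
  assumes bij: "\<And>j. j \<in> I \<Longrightarrow> bij_betw (f j) (X j) (X j)"
    and P: "\<And>x. x \<in> PiE I X \<Longrightarrow> P x \<longleftrightarrow> Q (\<lambda>j\<in>I. f j (x j))"
  shows "card {x \<in> PiE I X. P x} = card {x \<in> PiE I X. Q x}"
proof -
  let ?F = "\<lambda>x. \<lambda>j\<in>I. f j (x j)"
  have "inj_on ?F (PiE I X)"
  proof (rule inj_onI)
    fix x y assume xy: "x \<in> PiE I X" "y \<in> PiE I X" and eq: "?F x = ?F y"
    show "x = y"
    proof (rule PiE_ext[OF xy])
      fix j assume j: "j \<in> I"
      then have "f j (x j) = f j (y j)"
        using fun_cong[OF eq, of j] by simp
      with bij[OF j] xy j show "x j = y j"
        by (auto simp: bij_betw_def inj_on_def PiE_iff)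
    qed
  qed
  moreover have "?F ` {x \<in> PiE I X. P x} = {x \<in> PiE I X. Q x}"
  proof (intro equalityI subsetI)
    fix z assume "z \<in> ?F ` {x \<in> PiE I X. P x}"
    then obtain x where x: "x \<in> PiE I X" "P x" "z = ?F x"
      by blast
    have "?F x \<in> PiE I X"
      using bij_betwE[OF bij] x(1) by (auto simp: PiE_iff)
    with x P[OF x(1)] show "z \<in> {x \<in> PiE I X. Q x}"
      by simp
  next
    fix z assume z: "z \<in> {x \<in> PiE I X. Q x}"
    define x where "x = (\<lambda>j\<in>I. inv_into (X j) (f j) (z j))"
    have inv: "inv_into (X j) (f j) (z j) \<in> X j" "f j (inv_into (X j) (f j) (z j)) = z j"
      if "j \<in> I" for j
      using bij[OF that] z that
      by (auto simp: bij_betw_def PiE_iff inv_into_into f_inv_into_f)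
    have x: "x \<in> PiE I X"
      using inv by (simp add: x_def)
    have "?F x = z"
      using z inv by (auto simp: x_def fun_eq_iff PiE_iff extensional_def restrict_def)
    with x P[OF x] z show "z \<in> ?F ` {x \<in> PiE I X. P x}"
      by (auto intro: rev_image_eqI)
  qed
  ultimately show ?thesis
    by (metis (no_types, lifting) card_image inj_on_subset mem_Collect_eq subsetI)
qed

text \<open>Writing the torus as a product set lets coordinatewise substitutions apply to it as
  well.\<close>

lemma Nstar_eq_card_PiE:
  "Nstar n P = card {x \<in> PiE {1..n} (\<lambda>_. - {0::'a::{finite,zero}}). P x}"
  unfolding Nstar_def by (rule arg_cong[where f = card]) (auto simp: PiE_iff)

text \<open>The substitution \<open>x j ^ e j\<close>, with \<open>e j\<close> prime to
  \<open>q - 1\<close>, permutes both the field and its nonzero elements, and pulls the sum with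
  exponents \<open>d j\<close> back to the one with exponents \<open>m j\<close>.\<close>

lemma diagonal_sum_reduce_exponents:
  fixes a :: "nat \<Rightarrow> 'a::{field,finite}"
  assumes m: "\<forall>j\<in>{1..n}. m j > 0"
    and d: "\<forall>j\<in>{1..n}. d j = gcd (m j) (CARD('a) - 1)"
  shows "Npts n (\<lambda>x. (\<Sum>j=1..n. a j * x j ^ m j) = 0) = Npts n (\<lambda>x. (\<Sum>j=1..n. a j * x j ^ d j) = 0)"
    and "Nstar n (\<lambda>x. (\<Sum>j=1..n. a j * x j ^ m j) = 0) = Nstar n (\<lambda>x. (\<Sum>j=1..n. a j * x j ^ d j) = 0)"
proof -
  have "\<forall>j\<in>{1..n}. \<exists>e>0. coprime e (CARD('a) - 1) \<and> (\<forall>x::'a. (x ^ e) ^ d j = x ^ m j)"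
    using finite_field_power_gcd[where 'a = 'a] m d by simp
  then obtain e where e: "\<And>j. j \<in> {1..n} \<Longrightarrow> e j > 0"
      "\<And>j. j \<in> {1..n} \<Longrightarrow> coprime (e j) (CARD('a) - 1)"
      "\<And>j x. j \<in> {1..n} \<Longrightarrow> ((x::'a) ^ e j) ^ d j = x ^ m j"
    by metis
  have bij: "bij (\<lambda>x::'a. x ^ e j)" if "j \<in> {1..n}" for j
    using e that by (intro finite_field_power_bij) auto
  have bij': "bij_betw (\<lambda>x::'a. x ^ e j) (- {0}) (- {0})" if "j \<in> {1..n}" for j
  proof -
    have "(\<lambda>x::'a. x ^ e j) ` (- {0}) \<subseteq> - {0}"
      by auto
    with bij[OF that] show ?thesis
      unfolding bij_betw_def by (meson endo_inj_surj finite inj_on_subset subset_UNIV)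
  qed
  have eq: "(\<Sum>j=1..n. a j * x j ^ m j) = 0 \<longleftrightarrow>
      (\<Sum>j=1..n. a j * (\<lambda>j\<in>{1..n}. x j ^ e j) j ^ d j) = 0" for x
  proof -
    have "(\<Sum>j=1..n. a j * x j ^ m j) = (\<Sum>j=1..n. a j * (\<lambda>j\<in>{1..n}. x j ^ e j) j ^ d j)"
      by (rule sum.cong) (simp_all only: e(3) restrict_apply' refl)
    then show ?thesis
      by simp
  qed
  show "Npts n (\<lambda>x. (\<Sum>j=1..n. a j * x j ^ m j) = 0) = Npts n (\<lambda>x. (\<Sum>j=1..n. a j * x j ^ d j) = 0)"
    unfolding Npts_def by (rule card_PiE_reindex_coordinates[where f = "\<lambda>j x. x ^ e j"]) (rule bij eq, assumption?)+
  show "Nstar n (\<lambda>x. (\<Sum>j=1..n. a j * x j ^ m j) = 0) = Nstar n (\<lambda>x. (\<Sum>j=1..n. a j * x j ^ d j) = 0)"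
    unfolding Nstar_eq_card_PiE by (rule card_PiE_reindex_coordinates[where f = "\<lambda>j x. x ^ e j"]) (rule bij' eq, assumption?)+
qed

section \<open>Splitting off the torus and counting there by the group action\<close>

lemma Npts_eq_zero_coordinate_plus_Nstar:
  fixes P :: "(nat \<Rightarrow> 'a::{finite,zero}) \<Rightarrow> bool"
  shows "Npts n P = card {x \<in> PiE {1..n} (\<lambda>_. UNIV). (\<exists>j\<in>{1..n}. x j = 0) \<and> P x} + Nstar n P"
proof -
  have fin: "finite (PiE {1..n} (\<lambda>_. UNIV :: 'a set))"
    by (rule finite_PiE) auto
  show ?thesis
    unfolding Npts_def Nstar_def
    by (subst card_Un_disjoint[symmetric])
      (use fin in \<open>auto simp del: One_nat_def intro!: arg_cong[where f = card]\<close>)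
qed

text \<open>Double counting of the pairs \<open>(x, y)\<close> for which the diagonal sum at
  \<open>x\<close> is nonzero and \<open>y\<close> moves \<open>x\<close> to a solution: each such
  \<open>x\<close> has one \<open>y\<close>, and each \<open>y\<close> gives as many
  \<open>x\<close> as there are solutions.\<close>

lemma Nstar_power_equation:
  fixes a :: "nat \<Rightarrow> 'a::{field,finite}"
  assumes "b \<noteq> 0" "k > 0"
    and M: "\<forall>j\<in>{1..n}. m j dvd M"
    and gcd1: "gcd ((\<Sum>j=1..n. int (kk j * M div m j)) - int (k * M)) (int (CARD('a)) - 1) = 1"
  shows "(CARD('a) - 1) * Nstar n (\<lambda>x. (\<Sum>j=1..n. a j * x j ^ m j) ^ k = b * (\<Prod>j=1..n. x j ^ kk j))
         + Nstar n (\<lambda>x. (\<Sum>j=1..n. a j * x j ^ m j) = 0) = (CARD('a) - 1) ^ n"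
proof -
  let ?U = "- {0::'a}"
  let ?T = "PiE {1..n} (\<lambda>_. ?U)"
  define S where "S x = (\<Sum>j=1..n. a j * x j ^ m j)" for x
  define R where "R x = b * (\<Prod>j=1..n. x j ^ kk j)" for x
  define K where "K = (\<Sum>j=1..n. kk j * M div m j)"
  define act where "act y x = (\<lambda>j\<in>{1..n}. x j * y ^ (M div m j))" for y and x :: "nat \<Rightarrow> 'a"
  have fin: "finite ?T"
    by (rule finite_PiE) auto
  have cop: "coprime (int K - int (k * M)) (int (CARD('a) - 1))"
    using gcd1 by (simp add: K_def coprime_iff_gcd_eq_1 Suc_leI)
  have S_act: "S (act y x) = y ^ M * S x" for x y
    unfolding S_def sum_distrib_left
  proof (rule sum.cong)
    fix j assume "j \<in> {1..n}"
    then show "a j * act y x j ^ m j = y ^ M * (a j * x j ^ m j)"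
      using M by (simp add: act_def power_mult_distrib power_mult[symmetric])
  qed simp
  have R_act: "R (act y x) = y ^ K * R x" for x y
  proof -
    have "(\<Prod>j=1..n. act y x j ^ kk j) = (\<Prod>j=1..n. y ^ (kk j * M div m j) * x j ^ kk j)"
    proof (rule prod.cong)
      fix j assume j: "j \<in> {1..n}"
      then have "M div m j * kk j = kk j * M div m j"
        using M by (simp add: div_mult_swap mult.commute)
      then show "act y x j ^ kk j = y ^ (kk j * M div m j) * x j ^ kk j"
        using j by (simp add: act_def power_mult_distrib power_mult[symmetric])
    qed simp
    then show ?thesis
      by (simp add: R_def K_def prod.distrib power_sum)
  qed
  have R_nz: "R x \<noteq> 0" if "x \<in> ?T" for x
    using that \<open>b \<noteq> 0\<close> by (auto simp: R_def PiE_iff)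
  have unique_y: "card {y \<in> ?U. S (act y x) ^ k = R (act y x)} = 1"
    if x: "x \<in> ?T" and Sx: "S x \<noteq> 0" for x
  proof -
    \<comment> \<open>The action scales \<open>S x ^ k\<close> by \<open>y ^ (k * M)\<close> and
      \<open>R x\<close> by \<open>y ^ K\<close>, so only the quotient of these powers of
      \<open>y\<close> matters; coprimality then determines \<open>y\<close>.\<close>
    have "S (act y x) ^ k = R (act y x) \<longleftrightarrow> y powi (int K - int (k * M)) = S x ^ k / R x"
      if "y \<in> ?U" for y
    proof -
      have "S (act y x) ^ k = R (act y x) \<longleftrightarrow> y ^ (k * M) * S x ^ k = y ^ K * R x"
        by (simp add: S_act R_act power_mult_distrib power_mult[symmetric] mult.commute)
      moreover have "y powi (int K - int (k * M)) = y ^ K / y ^ (k * M)"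
        using that power_int_diff[of y "int K" "int (k * M)"] by (simp only: power_int_of_nat) simp
      ultimately show ?thesis
        using that R_nz[OF x] by (simp only:) (auto simp: field_simps)
    qed
    then have "{y \<in> ?U. S (act y x) ^ k = R (act y x)} =
        {y \<in> ?U. y powi (int K - int (k * M)) = S x ^ k / R x}"
      by blast
    moreover have "\<exists>!y. y \<in> ?U \<and> y powi (int K - int (k * M)) = S x ^ k / R x"
      using bij_betw_imp_surj_on[OF finite_field_powi_bij_betw[OF cop]]
        bij_betw_imp_inj_on[OF finite_field_powi_bij_betw[OF cop]] Sx R_nz[OF x]
      by (smt (verit) Compl_iff divide_eq_0_iff imageE inj_onD power_eq_0_iff singleton_iff)
    ultimately show ?thesis
      by (auto simp: card_1_singleton_iff)
  qed
  \<comment> \<open>The condition \<open>S x \<noteq> 0\<close> is automatic here: \<open>R\<close>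
    has no zero on the torus, so \<open>S (act y x)\<close>, a multiple of \<open>S x\<close>,
    cannot vanish at a solution.\<close>
  have act_card: "card {x \<in> ?T. S x \<noteq> 0 \<and> S (act y x) ^ k = R (act y x)} =
      card {x \<in> ?T. S x ^ k = R x}" if y: "y \<in> ?U" for y
  proof (rule card_PiE_reindex_coordinates)
    show "bij_betw (\<lambda>z. z * y ^ (M div m j)) ?U ?U" for j
      by (rule bij_betw_byWitness[where f' = "\<lambda>z. z / y ^ (M div m j)"]) (use y in auto)
    have act_T: "act y x \<in> ?T" if "x \<in> ?T" for x
      using that y by (auto simp: act_def PiE_iff)
    fix x assume x: "x \<in> ?T"
    show "S x \<noteq> 0 \<and> S (act y x) ^ k = R (act y x) \<longleftrightarrow>
        S (\<lambda>j\<in>{1..n}. x j * y ^ (M div m j)) ^ k = R (\<lambda>j\<in>{1..n}. x j * y ^ (M div m j))"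
      using R_nz[OF act_T[OF x]] \<open>k > 0\<close> S_act[of y x]
      unfolding act_def[symmetric] by (auto simp: zero_power)
  qed
  define T' where "T' = {x \<in> ?T. S x \<noteq> 0}"
  have "card T' = (\<Sum>x\<in>T'. card {y \<in> ?U. S (act y x) ^ k = R (act y x)})"
  proof -
    have "(\<Sum>x\<in>T'. card {y \<in> ?U. S (act y x) ^ k = R (act y x)}) = (\<Sum>x\<in>T'. 1)"
      by (intro sum.cong refl unique_y) (simp_all add: T'_def)
    then show ?thesis
      by simp
  qed
  also have "\<dots> = (\<Sum>y\<in>?U. card {x \<in> T'. S (act y x) ^ k = R (act y x)})"
    by (rule sum_multicount_gen) (use fin in \<open>auto simp: T'_def simp del: One_nat_def\<close>)
  also have "\<dots> = (\<Sum>y\<in>?U. card {x \<in> ?T. S x ^ k = R x})"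
    by (rule sum.cong) (simp_all only: T'_def mem_Collect_eq conj_assoc act_card)
  also have "\<dots> = (CARD('a) - 1) * card {x \<in> ?T. S x ^ k = R x}"
    by (simp add: Compl_eq_Diff_UNIV)
  finally have "(CARD('a) - 1) * card {x \<in> ?T. S x ^ k = R x} + card {x \<in> ?T. S x = 0} =
      card T' + card {x \<in> ?T. S x = 0}"
    by simp
  also have "\<dots> = card (T' \<union> {x \<in> ?T. S x = 0})"
    by (rule card_Un_disjoint[symmetric]) (use fin in \<open>auto simp: T'_def simp del: One_nat_def\<close>)
  also have "T' \<union> {x \<in> ?T. S x = 0} = ?T"
    unfolding T'_def by blast
  also have "card ?T = (CARD('a) - 1) ^ n"
    by (simp add: card_PiE Compl_eq_Diff_UNIV)
  finally show ?thesis
    by (simp add: Nstar_eq_card_PiE S_def R_def)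
qed

theorem theorem3:
  fixes a :: "nat \<Rightarrow> 'a::{field,finite}" and b :: 'a
    and n k M :: nat and m kk d :: "nat \<Rightarrow> nat"
  assumes "n \<ge> 2"
    and "\<forall>j\<in>{1..n}. a j \<noteq> 0" and "b \<noteq> 0"
    and "\<forall>j\<in>{1..n}. m j > 0" and "k > 0" and "\<forall>j\<in>{1..n}. kk j > 0"
    and "M = Lcm (m ` {1..n})"
    and "\<forall>j\<in>{1..n}. d j = gcd (m j) (CARD('a) - 1)"
    and "gcd ((\<Sum>j=1..n. int (kk j * M div m j)) - int (k * M)) (int (CARD('a)) - 1) = 1"
  shows "real (Npts n (\<lambda>x. (\<Sum>j=1..n. a j * x j ^ m j) ^ k = b * (\<Prod>j=1..n. x j ^ kk j)))
       = real (CARD('a) - 1) ^ (n - 1)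
         + real (Npts n (\<lambda>x. (\<Sum>j=1..n. a j * x j ^ d j) = 0))
         - real (CARD('a)) / real (CARD('a) - 1)
             * real (Nstar n (\<lambda>x. (\<Sum>j=1..n. a j * x j ^ d j) = 0))"
proof -
  let ?E = "\<lambda>x::nat \<Rightarrow> 'a. (\<Sum>j=1..n. a j * x j ^ m j) ^ k = b * (\<Prod>j=1..n. x j ^ kk j)"
  let ?Z = "\<lambda>x::nat \<Rightarrow> 'a. (\<Sum>j=1..n. a j * x j ^ m j) = 0"
  let ?D = "\<lambda>x::nat \<Rightarrow> 'a. (\<Sum>j=1..n. a j * x j ^ d j) = 0"
  define Q where "Q = real (CARD('a) - 1)"
  have card: "CARD('a) \<ge> 2"
    using card_mono[of "UNIV :: 'a set" "{0,1}"] by simp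
  then have Q: "Q > 0" "real (CARD('a)) = Q + 1"
    by (auto simp: Q_def)
  \<comment> \<open>Positive \<open>kk j\<close> make the monomial vanish, and positive
    \<open>k\<close> reduces a vanishing power to a vanishing base.\<close>
  have "?E x \<longleftrightarrow> ?Z x" if "\<exists>j\<in>{1..n}. x j = 0" for x
  proof -
    have "(\<Prod>j=1..n. x j ^ kk j) = 0"
      using that assms(6) by force
    with assms(5) show ?thesis
      by (simp only: mult_zero_right power_eq_0_iff simp_thms)
  qed
  then have "{x \<in> PiE {1..n} (\<lambda>_. UNIV). (\<exists>j\<in>{1..n}. x j = 0) \<and> ?E x} =
      {x \<in> PiE {1..n} (\<lambda>_. UNIV). (\<exists>j\<in>{1..n}. x j = 0) \<and> ?Z x}"
    by blast
  \<comment> \<open>Adding the torus counts crosswise avoids truncated subtraction of natural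
    numbers.\<close>
  then have "Npts n ?E + Nstar n ?Z = Npts n ?Z + Nstar n ?E"
    by (simp add: Npts_eq_zero_coordinate_plus_Nstar)
  then have "Npts n ?E + Nstar n ?D = Npts n ?D + Nstar n ?E"
    by (simp only: diagonal_sum_reduce_exponents[OF assms(4,8)])
  then have split: "real (Npts n ?E) = real (Npts n ?D) + real (Nstar n ?E) - real (Nstar n ?D)"
    by linarith
  have "(CARD('a) - 1) * Nstar n ?E + Nstar n ?Z = (CARD('a) - 1) ^ n"
    using Nstar_power_equation[OF assms(3,5) _ assms(9)] assms(7) by simp
  then have "(CARD('a) - 1) * Nstar n ?E + Nstar n ?D = (CARD('a) - 1) ^ n"
    by (simp only: diagonal_sum_reduce_exponents(2)[OF assms(4,8)])
  then have "Q * real (Nstar n ?E) + real (Nstar n ?D) = Q ^ n"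
    unfolding Q_def by (simp only: flip: of_nat_add of_nat_mult of_nat_power)
  moreover have "Q ^ n = Q * Q ^ (n - 1)"
    using assms(1) by (simp add: power_eq_if)
  ultimately have "real (Nstar n ?E) = Q ^ (n - 1) - real (Nstar n ?D) / Q"
    using Q(1) by (simp add: field_simps)
  \<comment> \<open>The coefficient \<open>q / (q - 1)\<close> is \<open>1 + 1 / Q\<close>: the
    \<open>1\<close> comes from removing the torus zeros, the \<open>1 / Q\<close> from the count of
    torus solutions.\<close>
  moreover have "(Q + 1) / Q * real (Nstar n ?D) = real (Nstar n ?D) + real (Nstar n ?D) / Q"
    using Q(1) by (simp add: field_simps)
  ultimately show ?thesis
    unfolding Q(2) Q_def[symmetric] using split by linarith
qed

end
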